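(* Let $n\in\mathbb{N}$ be arbitrary. The Laplacian spectrum of the enhanced power graph $\mathcal{P}_e(D_{2n})$ of the dihedral group $D_{2n}$ of order $2n$ is given by \[\begin{pmatrix}0 & 1 & n & 2n\\ 1 & n & n-2 & 1\end{pmatrix},\] i.e. the Laplacian eigenvalues are $0,1,n,2n$ with multiplicities $1,n,n-2,1$ respectively.
   Context: The dihedral group of order $2n$ is $D_{2n}=\langle a,b : a^{n}=b^2=e,\ bab^{-1}=a^{-1}\rangle$. The enhanced power graph $\mathcal{P}_e(G)$ of a group $G$ is the simple undirected graph with vertex set $G$ in which two distinct vertices $x,y$ are adjacent if and only if $x,y\in\langle z\rangle$ for some $z\in G$. The Laplacian matrix of a finite simple graph $\Gamma$ is $L(\Gamma)=D(\Gamma)-A(\Gamma)$, where $A(\Gamma)$ is the adjacency matrix and $D(\Gamma)$ the diagonal matrix of vertex degrees. The Laplacian spectrum of $\Gamma$ is the spectrum of $L(\Gamma)$, displayed as a two-row array with the eigenvalues in the first row and their multiplicities in the second. *)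

theory Defs
  imports
    "HOL-Algebra.Generated_Groups"
    "Graph_Theory.Pair_Digraph"
    "Jordan_Normal_Form.Char_Poly"
begin

section \<open>Groups given by generators and relations\<close>

text \<open>A letter \<open>(x, True)\<close> stands for the generator \<open>x\<close>, \<open>(x, False)\<close> for its formal inverse.
  A relation \<open>u = v\<close> is the pair \<open>(u, v)\<close> of words.\<close>

type_synonym 'g word = "('g \<times> bool) list"

inductive word_eq :: "('g word \<times> 'g word) set \<Rightarrow> 'g word \<Rightarrow> 'g word \<Rightarrow> bool"
  for R where
  rel: "(u, v) \<in> R \<Longrightarrow> word_eq R u v"
| cancel: "word_eq R [(x, s), (x, \<not> s)] []"
| refl: "word_eq R u u"
| sym: "word_eq R u v \<Longrightarrow> word_eq R v u"
| trans: "word_eq R u v \<Longrightarrow> word_eq R v w \<Longrightarrow> word_eq R u w"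
| append: "word_eq R u u' \<Longrightarrow> word_eq R v v' \<Longrightarrow> word_eq R (u @ v) (u' @ v')"

definition word_class :: "('g word \<times> 'g word) set \<Rightarrow> 'g word \<Rightarrow> 'g word set" where
  "word_class R u = {v. word_eq R u v}"

text \<open>The generating set consists of all elements of the type \<open>'g\<close>.\<close>

definition presented_group :: "('g word \<times> 'g word) set \<Rightarrow> 'g word set monoid" where
  "presented_group R =
    \<lparr> carrier = range (word_class R),
      monoid.mult = (\<lambda>U V. \<Union>u\<in>U. \<Union>v\<in>V. word_class R (u @ v)),
      monoid.one = word_class R [] \<rparr>"

lemma word_class_eq_iff: "word_class R u = word_class R v \<longleftrightarrow> word_eq R u v"
  unfolding word_class_def
  by (auto intro: word_eq.refl word_eq.sym word_eq.trans)

lemma mult_word_class: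
  "word_class R u \<otimes>\<^bsub>presented_group R\<^esub> word_class R v = word_class R (u @ v)"
proof -
  have "word_class R (u' @ v') = word_class R (u @ v)"
    if "word_eq R u u'" "word_eq R v v'" for u' v'
    using that by (auto simp: word_class_eq_iff intro: word_eq.append word_eq.sym)
  then show ?thesis
    unfolding presented_group_def
    by (auto simp: word_class_def[of R u] word_class_def[of R v] intro: word_eq.refl)
qed

lemma one_presented_group: "\<one>\<^bsub>presented_group R\<^esub> = word_class R []"
  by (simp add: presented_group_def)

lemma carrier_presented_group: "carrier (presented_group R) = range (word_class R)"
  by (simp add: presented_group_def)

lemma word_eq_left_inverse: "word_eq R (rev (map (\<lambda>(x, s). (x, \<not> s)) u) @ u) []"
proof (induction u)
  case Nil
  show ?case by (simp add: word_eq.refl)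
next
  case (Cons a u)
  obtain x s where a: "a = (x, s)" by fastforce
  define w where "w = rev (map (\<lambda>(x, s). (x, \<not> s)) u)"
  have "word_eq R [(x, \<not> s), (x, s)] []"
    using word_eq.cancel[of R x "\<not> s"] by simp
  then have "word_eq R (w @ [(x, \<not> s), (x, s)] @ u) (w @ [] @ u)"
    by (intro word_eq.append word_eq.refl)
  then show ?case
    using Cons.IH by (auto simp: a w_def intro: word_eq.trans)
qed

lemma group_presented_group: "group (presented_group R)"
proof (rule groupI)
  fix U assume "U \<in> carrier (presented_group R)"
  then obtain u where "U = word_class R u"
    by (auto simp: carrier_presented_group)
  then show "\<exists>V\<in>carrier (presented_group R).
      V \<otimes>\<^bsub>presented_group R\<^esub> U = \<one>\<^bsub>presented_group R\<^esub>"
    by (intro bexI[of _ "word_class R (rev (map (\<lambda>(x, s). (x, \<not> s)) u))"])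
      (auto simp: carrier_presented_group mult_word_class one_presented_group
        word_class_eq_iff word_eq_left_inverse)
qed (auto simp: carrier_presented_group mult_word_class one_presented_group)


section \<open>The dihedral group\<close>

datatype dihedral_gen = Gen_a | Gen_b

definition dihedral_relations :: "nat \<Rightarrow> (dihedral_gen word \<times> dihedral_gen word) set" where
  "dihedral_relations n =
    {(replicate n (Gen_a, True), []),
     ([(Gen_b, True), (Gen_b, True)], []),
     ([(Gen_b, True), (Gen_a, True), (Gen_b, False)], [(Gen_a, False)])}"

text \<open>\<open>dihedral_group n\<close> is \<open>D\<^sub>2\<^sub>n\<close>: the index \<open>n\<close> is half of the order.\<close>

definition dihedral_group :: "nat \<Rightarrow> dihedral_gen word set monoid" where
  "dihedral_group n = presented_group (dihedral_relations n)"


section \<open>The enhanced power graph\<close>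

text \<open>A simple undirected graph is a symmetric loop-free digraph, cf. the locale
  \<open>pair_graph\<close>; an edge is represented by its two orientations.\<close>

definition enhanced_power_graph :: "('a, 'm) monoid_scheme \<Rightarrow> 'a pair_pre_digraph" where
  "enhanced_power_graph G =
    \<lparr> pverts = carrier G,
      parcs = {(x, y). x \<in> carrier G \<and> y \<in> carrier G \<and> x \<noteq> y \<and>
        (\<exists>z\<in>carrier G. x \<in> generate G {z} \<and> y \<in> generate G {z})} \<rparr>"

lemma pair_graph_enhanced_power_graph:
  assumes "finite (carrier G)"
  shows "pair_graph (enhanced_power_graph G)"
proof -
  have "parcs (enhanced_power_graph G) \<subseteq> carrier G \<times> carrier G"
    by (auto simp: enhanced_power_graph_def)
  then have "finite (parcs (enhanced_power_graph G))"
    using assms finite_subset by blast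
  then show ?thesis
    using assms
    by unfold_locales
      (auto simp: enhanced_power_graph_def symmetric_def intro!: symI)
qed


section \<open>The Laplacian spectrum\<close>

text \<open>The list \<open>vs\<close> enumerates the vertices. In a symmetric digraph the out-degree of a vertex
  is its degree in the underlying undirected graph.\<close>

definition adjacency_mat :: "'a pair_pre_digraph \<Rightarrow> 'a list \<Rightarrow> real mat" where
  "adjacency_mat \<Gamma> vs = mat (length vs) (length vs)
    (\<lambda>(i, j). if (vs ! i, vs ! j) \<in> parcs \<Gamma> then 1 else 0)"

definition degree_mat :: "'a pair_pre_digraph \<Rightarrow> 'a list \<Rightarrow> real mat" where
  "degree_mat \<Gamma> vs = mat_diag (length vs) (\<lambda>i. real (out_degree (with_proj \<Gamma>) (vs ! i)))"

definition laplacian_mat :: "'a pair_pre_digraph \<Rightarrow> 'a list \<Rightarrow> real mat" where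
  "laplacian_mat \<Gamma> vs = degree_mat \<Gamma> vs - adjacency_mat \<Gamma> vs"

text \<open>A two-row array is the list of its columns (eigenvalue, multiplicity). The multiplicity
  of \<open>\<mu>\<close> is the sum over all columns with eigenvalue \<open>\<mu>\<close>, hence \<open>0\<close> if there is none; this matters
  when the entries of the first row depend on parameters and may coincide. Multiplicities in an
  array are integers, so that an expression such as \<open>n - 2\<close> is not truncated.\<close>

definition array_multiplicity :: "('b \<times> int) list \<Rightarrow> 'b \<Rightarrow> int" where
  "array_multiplicity arr \<mu> = (\<Sum>(ev, m)\<leftarrow>arr. if ev = \<mu> then m else 0)"

text \<open>Eigenvalues are counted with algebraic multiplicity. They do not depend on the enumeration
  of the vertices. The Laplacian matrix is real symmetric, so all its eigenvalues are real.\<close>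

definition has_laplacian_spectrum :: "'a pair_pre_digraph \<Rightarrow> (real \<times> int) list \<Rightarrow> bool" where
  "has_laplacian_spectrum \<Gamma> arr \<longleftrightarrow> pair_graph \<Gamma> \<and>
    (\<forall>vs. distinct vs \<and> set vs = pverts \<Gamma> \<longrightarrow>
      (\<forall>\<mu>. int (Polynomial.order \<mu> (char_poly (laplacian_mat \<Gamma> vs))) = array_multiplicity arr \<mu>))"

end

theory Submission
  imports Defs "HOL-Algebra.Multiplicative_Group"
begin

text \<open>
  In \<open>D\<^sub>2\<^sub>n\<close> every element outside the cyclic subgroup \<open>\<langle>a\<rangle>\<close> is an involution, since \<open>b\<close> inverts
  \<open>\<langle>a\<rangle>\<close> by conjugation. A cyclic subgroup is therefore either contained in \<open>\<langle>a\<rangle>\<close> or of the form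
  \<open>{e, x}\<close>. Hence the enhanced power graph consists of the complete graph on the \<open>n\<close> elements of
  \<open>\<langle>a\<rangle>\<close> and of the \<open>n\<close> remaining elements, each a pendant vertex attached to \<open>e\<close>
  (\<open>parcs_enhanced_power_graph_involutions\<close>).

  The spectrum of a complete graph on a set \<open>K\<close> with pendant vertices at a point \<open>e \<in> K\<close>
  (\<open>laplacian_spectrum_clique_with_pendants\<close>) comes from a basis in which the Laplacian \<open>L\<close> is
  upper triangular. Let \<open>V\<close> be the vertex set, write \<open>x\<close> also for the unit vector at \<open>x\<close>, and let
  \<open>j\<close> be the all-ones vector. Then
  \<open>L j = 0\<close>, \<open>L e = |V| e - j\<close>, \<open>L s = s - e\<close> for a pendant vertex \<open>s\<close>, and
  \<open>L r = |K| r - j + (sum of all pendant vertices)\<close> for \<open>r \<in> K - {e}\<close>. So replacing one unit vector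
  \<open>w\<close> by \<open>j\<close> and ordering the basis as \<open>j\<close>, \<open>e\<close>, pendant vertices, rest of \<open>K\<close> makes \<open>L\<close> upper
  triangular, with the diagonal \<open>0, |V|, 1, \<dots>, 1, |K|, \<dots>, |K|\<close>. The vertex \<open>w\<close> is taken from
  \<open>K - {e}\<close>; if \<open>K = {e}\<close>, the graph is a star and any other vertex serves, which
  leaves one eigenvalue \<open>1\<close> less. That is what the entry \<open>|K| - 2 = -1\<close> accounts for.

  For the presented group two things have to be shown: the relations are strong enough, so that
  \<open>\<langle>a\<rangle>\<close> and its coset \<open>\<langle>a\<rangle>b\<close> exhaust the group (\<open>generate_inverting_involution\<close>), and they are not
  too strong, so that \<open>a\<close> really has order \<open>n\<close> and \<open>b \<notin> \<langle>a\<rangle>\<close>. The latter follows from two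
  invariants of words (\<open>word_eq_dihedral_invariants\<close>).
\<close>

section \<open>Matrices with rows and columns indexed by enumerated sets\<close>

text \<open>Indexing entries by vertices instead of positions turns matrix identities into identities
  of finite sums over the vertex set, whatever enumeration is used.\<close>

definition kernel_mat :: "('a \<Rightarrow> 'b \<Rightarrow> 'r) \<Rightarrow> 'a list \<Rightarrow> 'b list \<Rightarrow> 'r mat" where
  "kernel_mat f xs ys = mat (length xs) (length ys) (\<lambda>(i, j). f (xs ! i) (ys ! j))"

lemma kernel_mat_carrier [simp]: "kernel_mat f xs ys \<in> carrier_mat (length xs) (length ys)"
  by (simp add: kernel_mat_def)

lemma kernel_mat_cong:
  "(\<And>x y. x \<in> set xs \<Longrightarrow> y \<in> set ys \<Longrightarrow> f x y = g x y) \<Longrightarrow> kernel_mat f xs ys = kernel_mat g xs ys"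
  by (auto simp: kernel_mat_def intro!: eq_matI)

lemma kernel_mat_mult:
  fixes f :: "'a \<Rightarrow> 'b \<Rightarrow> 'r::comm_semiring_1"
  assumes "distinct ys"
  shows "kernel_mat f xs ys * kernel_mat g ys zs = kernel_mat (\<lambda>x z. \<Sum>y\<in>set ys. f x y * g y z) xs zs"
proof (rule eq_matI)
  fix i j
  assume "i < dim_row (kernel_mat (\<lambda>x z. \<Sum>y\<in>set ys. f x y * g y z) xs zs)"
    and "j < dim_col (kernel_mat (\<lambda>x z. \<Sum>y\<in>set ys. f x y * g y z) xs zs)"
  then have ij: "i < length xs" "j < length zs"
    by (simp_all add: kernel_mat_def)
  have "(kernel_mat f xs ys * kernel_mat g ys zs) $$ (i, j)
      = (\<Sum>l = 0..<length ys. f (xs ! i) (ys ! l) * g (ys ! l) (zs ! j))"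
    using ij by (simp add: kernel_mat_def scalar_prod_def)
  also have "\<dots> = (\<Sum>y\<in>set ys. f (xs ! i) y * g y (zs ! j))"
    using bij_betw_nth[OF assms, of "{0..<length ys}" "set ys"]
    by (intro sum.reindex_bij_betw) (auto simp: atLeast0LessThan)
  finally show "(kernel_mat f xs ys * kernel_mat g ys zs) $$ (i, j)
      = kernel_mat (\<lambda>x z. \<Sum>y\<in>set ys. f x y * g y z) xs zs $$ (i, j)"
    using ij by (simp add: kernel_mat_def)
qed (simp_all add: kernel_mat_def)

lemma kernel_mat_one:
  assumes "distinct xs"
    and "\<And>x y. x \<in> set xs \<Longrightarrow> y \<in> set xs \<Longrightarrow> f x y = (if x = y then 1 else 0)"
  shows "kernel_mat f xs xs = 1\<^sub>m (length xs)"
  by (rule eq_matI) (use assms in \<open>auto simp: kernel_mat_def nth_eq_iff_index_eq\<close>)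

text \<open>Rows and columns of the two matrices may be enumerated differently: the change of basis
  given by \<open>P\<close> absorbs the permutation, its rows being enumerated by \<open>vs\<close> and its columns by
  \<open>us\<close>.\<close>

lemma similar_kernel_mat:
  fixes L T P Q :: "'a \<Rightarrow> 'a \<Rightarrow> 'r::comm_ring_1"
  assumes vs: "distinct vs" "set vs = V" and us: "distinct us" "set us = V"
    and PQ: "\<And>x y. x \<in> V \<Longrightarrow> y \<in> V \<Longrightarrow> (\<Sum>z\<in>V. P x z * Q z y) = (if x = y then 1 else 0)"
    and QP: "\<And>x y. x \<in> V \<Longrightarrow> y \<in> V \<Longrightarrow> (\<Sum>z\<in>V. Q x z * P z y) = (if x = y then 1 else 0)"
    and LP: "\<And>x y. x \<in> V \<Longrightarrow> y \<in> V \<Longrightarrow> (\<Sum>z\<in>V. L x z * P z y) = (\<Sum>z\<in>V. P x z * T z y)"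
  shows "similar_mat (kernel_mat L vs vs) (kernel_mat T us us)"
proof -
  have len: "length us = length vs"
    using vs us by (metis distinct_card)
  define A B p q where "A = kernel_mat L vs vs" and "B = kernel_mat T us us"
    and "p = kernel_mat P vs us" and "q = kernel_mat Q us vs"
  have car: "A \<in> carrier_mat (length vs) (length vs)" "B \<in> carrier_mat (length vs) (length vs)"
      "p \<in> carrier_mat (length vs) (length vs)" "q \<in> carrier_mat (length vs) (length vs)"
    using kernel_mat_carrier len unfolding A_def B_def p_def q_def by metis+
  have pq: "p * q = 1\<^sub>m (length vs)"
    unfolding p_def q_def kernel_mat_mult[OF us(1)]
    by (rule kernel_mat_one) (use vs us PQ in auto)
  have qp: "q * p = 1\<^sub>m (length vs)"
    unfolding p_def q_def kernel_mat_mult[OF vs(1)] len[symmetric]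
    by (rule kernel_mat_one) (use vs us QP in auto)
  have "A * p = p * B"
    unfolding A_def B_def p_def kernel_mat_mult[OF us(1)] kernel_mat_mult[OF vs(1)]
    by (rule kernel_mat_cong) (use vs us LP in auto)
  then have "p * B * q = A * (p * q)"
    using car by (metis assoc_mult_mat)
  then have "A = p * B * q"
    using car by (simp add: pq)
  with car pq qp show ?thesis
    unfolding A_def[symmetric] B_def[symmetric]
    by (intro similar_matI[of A B p q "length vs"]) auto
qed

text \<open>If the all-ones vector \<open>j\<close> lies in the kernel of \<open>L\<close>, this is \<open>L\<close> in the basis of unit vectors
  in which the one at \<open>w\<close> is replaced by \<open>j\<close>. In that basis a vector \<open>v\<close> has the coordinate \<open>v w\<close>
  at \<open>w\<close> and \<open>v x - v w\<close> at every other \<open>x\<close>.\<close>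

definition deflate :: "'a \<Rightarrow> ('a \<Rightarrow> 'a \<Rightarrow> 'r::comm_ring_1) \<Rightarrow> 'a \<Rightarrow> 'a \<Rightarrow> 'r" where
  "deflate w L x y = (if y = w then 0 else if x = w then L w y else L x y - L w y)"

lemma similar_deflate:
  fixes L :: "'a \<Rightarrow> 'a \<Rightarrow> 'r::comm_ring_1"
  assumes vs: "distinct vs" "set vs = V" and us: "distinct us" "set us = V"
    and w: "w \<in> V" and rows: "\<And>x. x \<in> V \<Longrightarrow> (\<Sum>y\<in>V. L x y) = 0"
  shows "similar_mat (kernel_mat L vs vs) (kernel_mat (deflate w L) us us)"
proof (rule similar_kernel_mat[OF vs us])
  \<comment> \<open>Column \<open>w\<close> of \<open>P\<close> is the all-ones vector, all other columns are unit vectors. The difference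
    \<open>N\<close> of \<open>P\<close> and the identity satisfies \<open>N * N = 0\<close>, as \<open>c w = 0\<close>; so \<open>Q\<close> is the identity minus \<open>N\<close>.\<close>
  define c :: "'a \<Rightarrow> 'r" where "c x = (if x = w then 0 else 1)" for x
  let ?P = "\<lambda>x y. (if x = y then 1 else 0) + (if y = w then c x else 0)"
  let ?Q = "\<lambda>x y. (if x = y then 1 else 0) - (if y = w then c x else 0)"
  have fin: "finite V" using vs by auto
  have mult_P: "(\<Sum>z\<in>V. ?P x z * f z) = f x + c x * f w" if "x \<in> V" for x and f :: "'a \<Rightarrow> 'r"
    using fin w that
    by (simp add: distrib_right sum.distrib if_distrib[of "\<lambda>t. t * _"] cong: if_cong)
  have mult_Q: "(\<Sum>z\<in>V. ?Q x z * f z) = f x - c x * f w" if "x \<in> V" for x and f :: "'a \<Rightarrow> 'r"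
    using fin w that
    by (simp add: left_diff_distrib sum_subtractf if_distrib[of "\<lambda>t. t * _"] cong: if_cong)
  fix x y assume xy: "x \<in> V" "y \<in> V"
  show "(\<Sum>z\<in>V. ?P x z * ?Q z y) = (if x = y then 1 else 0)"
    using xy by (simp add: mult_P) (auto simp: c_def)
  show "(\<Sum>z\<in>V. ?Q x z * ?P z y) = (if x = y then 1 else 0)"
    using xy by (simp add: mult_Q) (auto simp: c_def)
  have "(\<Sum>z\<in>V. L x z * ?P z y) = (if y = w then 0 else L x y)"
  proof (cases "y = w")
    case True
    have "L x z * ?P z w = L x z" for z by (simp add: c_def)
    then show ?thesis
      using True rows[OF xy(1)] by simp
  next
    case False
    then show ?thesis
      using fin xy by (simp add: if_distrib[of "\<lambda>t. _ * t"] cong: if_cong)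
  qed
  also have "\<dots> = (\<Sum>z\<in>V. ?P x z * deflate w L z y)"
    using xy by (simp add: mult_P) (auto simp: deflate_def c_def)
  finally show "(\<Sum>z\<in>V. L x z * ?P z y) = (\<Sum>z\<in>V. ?P x z * deflate w L z y)" .
qed

section \<open>The Laplacian matrix\<close>

definition laplacian_entry :: "'a pair_pre_digraph \<Rightarrow> 'a \<Rightarrow> 'a \<Rightarrow> real" where
  "laplacian_entry \<Gamma> x y = (if x = y then real (card {z. (x, z) \<in> parcs \<Gamma>}) else 0)
     - (if (x, y) \<in> parcs \<Gamma> then 1 else 0)"

lemma out_degree_with_proj: "out_degree (with_proj \<Gamma>) x = card {y. (x, y) \<in> parcs \<Gamma>}"
proof -
  have "out_arcs (with_proj \<Gamma>) x = Pair x ` {y. (x, y) \<in> parcs \<Gamma>}"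
    by (auto simp: out_arcs_def with_proj_def)
  then show ?thesis
    by (simp add: out_degree_def card_image inj_on_def)
qed

lemma laplacian_mat_eq_kernel_mat:
  assumes "distinct vs"
  shows "laplacian_mat \<Gamma> vs = kernel_mat (laplacian_entry \<Gamma>) vs vs"
  by (rule eq_matI)
    (use assms in \<open>auto simp: laplacian_mat_def degree_mat_def adjacency_mat_def mat_diag_def
      kernel_mat_def laplacian_entry_def out_degree_with_proj nth_eq_iff_index_eq\<close>)

lemma laplacian_entry_row_sum:
  assumes "finite V" "parcs \<Gamma> \<subseteq> V \<times> V" "x \<in> V"
  shows "(\<Sum>y\<in>V. laplacian_entry \<Gamma> x y) = 0"
proof -
  have "V \<inter> {y. (x, y) \<in> parcs \<Gamma>} = {y. (x, y) \<in> parcs \<Gamma>}"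
    using assms by auto
  then show ?thesis
    using assms by (simp add: laplacian_entry_def sum_subtractf sum.If_cases)
qed

lemma order_prod_linear_factors:
  "Polynomial.order \<mu> (\<Prod>a\<leftarrow>as. [:- a, 1:]) = count_list as (\<mu>::real)"
proof (induction as)
  case (Cons a as)
  have "(\<Prod>a\<leftarrow>a # as. [:- a, 1:]) \<noteq> 0"
    unfolding prod_list_zero_iff by auto
  moreover have "Polynomial.order \<mu> [:- a, 1:] = (if a = \<mu> then 1 else 0)"
    using order_power_n_n[of a 1] by (auto simp: order_0I)
  ultimately show ?case
    using Cons by (simp add: order_mult del: mult_pCons_left)
qed (simp add: order_0I)

text \<open>\<open>sorted_wrt\<close> relates earlier to later entries of the list, so the condition says that the
  entries below the diagonal vanish.\<close>

lemma order_char_poly_kernel_mat_upper_triangular: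
  fixes T :: "'a \<Rightarrow> 'a \<Rightarrow> real"
  assumes "sorted_wrt (\<lambda>x y. T y x = 0) us"
  shows "Polynomial.order \<mu> (char_poly (kernel_mat T us us)) = count_list (map (\<lambda>x. T x x) us) \<mu>"
proof -
  have "upper_triangular (kernel_mat T us us)"
    using assms by (auto simp: upper_triangular_def kernel_mat_def sorted_wrt_iff_nth_less)
  then have "char_poly (kernel_mat T us us) = (\<Prod>a\<leftarrow>diag_mat (kernel_mat T us us). [:- a, 1:])"
    by (rule char_poly_upper_triangular[OF kernel_mat_carrier])
  moreover have "diag_mat (kernel_mat T us us) = map (\<lambda>x. T x x) us"
    by (auto simp: diag_mat_def kernel_mat_def intro!: nth_equalityI)
  ultimately show ?thesis
    by (simp only: order_prod_linear_factors)
qed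

section \<open>A complete graph with pendant vertices at one point\<close>

lemma count_list_map_const:
  "(\<And>x. x \<in> set xs \<Longrightarrow> f x = c) \<Longrightarrow> count_list (map f xs) \<mu> = (if c = \<mu> then length xs else 0)"
  by (induction xs) auto

text \<open>The argument is that of the introduction: \<open>us\<close> is the ordering that makes the Laplacian upper
  triangular once the unit vector at \<open>w\<close> is replaced by the all-ones vector. Multiplicities are
  compared as functions of \<open>\<mu>\<close>, so coincidences among \<open>1\<close>, \<open>card K\<close> and \<open>card V\<close> cause no case
  distinction.\<close>

lemma laplacian_spectrum_clique_with_pendants:
  fixes \<Gamma> :: "'a pair_pre_digraph"
  assumes fin: "finite V" and V: "pverts \<Gamma> = V" and K: "K \<subseteq> V" "e \<in> K" and two: "2 \<le> card V"
    and arcs: "parcs \<Gamma> = {(x, y). x \<in> V \<and> y \<in> V \<and> x \<noteq> y \<and>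
      (x = e \<or> y = e \<or> (x \<in> K \<and> y \<in> K))}"
  shows "has_laplacian_spectrum \<Gamma> [(0, 1), (1, int (card (V - K))),
    (real (card K), int (card K) - 2), (real (card V), 1)]"
proof -
  have sub: "parcs \<Gamma> \<subseteq> V \<times> V"
    using arcs by auto
  have pg: "pair_graph \<Gamma>"
    using fin V finite_subset[OF sub]
    by unfold_locales (auto simp: arcs symmetric_def intro!: symI)
  let ?L = "laplacian_entry \<Gamma>"
  have eV: "e \<in> V" and finK: "finite K"
    using K fin finite_subset by auto
  have nbrs_e: "{z. (e, z) \<in> parcs \<Gamma>} = V - {e}"
    using eV by (auto simp: arcs)
  have nbrs_K: "{z. (x, z) \<in> parcs \<Gamma>} = K - {x}" if "x \<in> K" "x \<noteq> e" for x
    using that K by (auto simp: arcs)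
  have nbrs_out: "{z. (x, z) \<in> parcs \<Gamma>} = {e}" if "x \<in> V - K" for x
    using that K by (auto simp: arcs)
  have L_e: "?L e e = real (card V) - 1"
    using eV fin two by (simp add: laplacian_entry_def nbrs_e) (simp add: arcs of_nat_diff)
  have L_K: "?L x x = real (card K) - 1" if "x \<in> K" "x \<noteq> e" for x
  proof -
    have "1 \<le> card K"
      using K finK by (metis card_gt_0_iff empty_iff One_nat_def Suc_leI)
    then show ?thesis
      using that finK by (simp add: laplacian_entry_def nbrs_K) (simp add: arcs of_nat_diff)
  qed
  have L_out: "?L x x = 1" if "x \<in> V - K" for x
    using that by (simp add: laplacian_entry_def nbrs_out) (simp add: arcs)
  have L_off: "?L x y = (if x = e \<or> y = e \<or> (x \<in> K \<and> y \<in> K) then - 1 else 0)"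
    if "x \<in> V" "y \<in> V" "x \<noteq> y" for x y
    using that by (simp add: laplacian_entry_def arcs)
  have "V \<noteq> {e}"
    using two by auto
  \<comment> \<open>A vertex \<open>r \<in> K\<close> other than \<open>e\<close> and \<open>w\<close> can only exist if \<open>w \<in> K\<close>. This matters below: the
    off-diagonal entries \<open>- 1\<close> in column \<open>r\<close> of the Laplacian vanish when row \<open>w\<close> is subtracted.\<close>
  then obtain w where w: "w \<in> V" "w \<noteq> e" and wK: "w \<in> K \<or> K = {e}"
    using eV K by blast
  obtain ss where ss: "distinct ss" "set ss = V - K - {w}"
    using finite_distinct_list[of "V - K - {w}"] fin by auto
  obtain rs where rs: "distinct rs" "set rs = K - {e, w}"
    using finite_distinct_list[of "K - {e, w}"] finK by auto
  define us where "us = w # e # ss @ rs"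
  have us: "distinct us" "set us = V"
    using ss rs w K eV by (auto simp: us_def)
  let ?T = "deflate w ?L"
  have T_r: "w \<in> K" if "x \<in> set rs" for x
    using that rs wK by auto
  have in_us: "x \<in> V" if "x \<in> set ss \<union> set rs" for x
    using that ss rs K by auto
  have T_ss: "?T x y = 0" if "x \<in> V" "y \<in> set ss" "x \<noteq> y" "x \<noteq> e" for x y
  proof -
    have y: "y \<in> V" "y \<notin> K" "y \<noteq> e" "y \<noteq> w"
      using that ss K by auto
    then have "?L x y = 0" "?L w y = 0"
      using that w by (simp_all add: L_off)
    then show ?thesis
      using y by (simp add: deflate_def)
  qed
  have T_rs: "?T x y = 0" if "x \<in> set rs" "y \<in> set rs" "x \<noteq> y" for x y
  proof -
    have "x \<noteq> w" "y \<noteq> w" "x \<in> K" "y \<in> K" "w \<in> K"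
      using that rs T_r by auto
    then show ?thesis
      using that in_us w by (simp add: deflate_def L_off)
  qed
  have T_e: "?T x e = 0" if "x \<in> set ss \<union> set rs" for x
  proof -
    have "x \<noteq> w" "x \<noteq> e" "x \<in> V"
      using that ss rs K by auto
    then show ?thesis
      using w eV by (simp add: deflate_def L_off)
  qed
  have T_w: "?T x w = 0" for x
    by (simp add: deflate_def)
  have tri: "sorted_wrt (\<lambda>x y. ?T y x = 0) us"
  proof -
    have distinct_sorted: "sorted_wrt R xs"
      if "distinct xs" "\<And>x y. x \<in> set xs \<Longrightarrow> y \<in> set xs \<Longrightarrow> x \<noteq> y \<Longrightarrow> R x y"
      for xs and R :: "'a \<Rightarrow> 'a \<Rightarrow> bool"
      using that by (induction xs) auto
    have "sorted_wrt (\<lambda>x y. ?T y x = 0) ss"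
    proof (rule distinct_sorted[OF ss(1)])
      fix x y assume xy: "x \<in> set ss" "y \<in> set ss" "x \<noteq> y"
      then have "y \<noteq> e"
        using ss K by auto
      with xy show "?T y x = 0"
        using in_us by (intro T_ss) auto
    qed
    moreover have "sorted_wrt (\<lambda>x y. ?T y x = 0) rs"
      by (rule distinct_sorted[OF rs(1)]) (auto intro: T_rs)
    moreover have "?T y x = 0" if "x \<in> set ss" "y \<in> set rs" for x y
    proof (rule T_ss)
      show "y \<in> V" "x \<in> set ss" "y \<noteq> x" "y \<noteq> e"
        using that rs ss K by auto
    qed
    ultimately show ?thesis
      unfolding us_def by (simp add: sorted_wrt_append T_e T_w)
  qed
  have diag_w: "?T w w = 0"
    by (rule T_w)
  have diag_e: "?T e e = real (card V)"
    using w eV by (simp add: deflate_def L_off L_e)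
  have diag_ss: "?T x x = 1" if "x \<in> set ss" for x
  proof -
    have "x \<in> V" "x \<notin> K" "x \<noteq> e" "x \<noteq> w"
      using that ss K by auto
    then show ?thesis
      using w by (simp add: deflate_def L_off L_out)
  qed
  have diag_rs: "?T x x = real (card K)" if "x \<in> set rs" for x
  proof -
    have "x \<in> V" "x \<in> K" "w \<in> K" "x \<noteq> e" "x \<noteq> w"
      using that rs in_us T_r by auto
    then show ?thesis
      using w by (simp add: deflate_def L_off L_K)
  qed
  have count: "int (count_list (map (\<lambda>x. ?T x x) us) \<mu>) = array_multiplicity
      [(0, 1), (1, int (card (V - K))), (real (card K), int (card K) - 2), (real (card V), 1)] \<mu>" for \<mu>
  proof -
    have T: "count_list (map (\<lambda>x. ?T x x) us) \<mu> = (if 0 = \<mu> then 1 else 0)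
        + (if real (card V) = \<mu> then 1 else 0) + (if 1 = \<mu> then length ss else 0)
        + (if real (card K) = \<mu> then length rs else 0)"
      by (simp add: us_def diag_w diag_e diag_ss diag_rs count_list_map_const[of ss _ 1]
          count_list_map_const[of rs _ "real (card K)"])
    have ss_rs: "length ss = card (V - K - {w})" "length rs = card (K - {e, w})"
      using ss rs distinct_card by metis+
    show ?thesis
    proof (cases "w \<in> K")
      case True
      then have "V - K - {w} = V - K"
        by auto
      moreover have "card (K - {e, w}) = card K - 2"
        using True w K finK by (simp add: card_Diff_subset)
      moreover have "2 \<le> card K"
        using True w K card_mono[OF finK, of "{e, w}"] by auto
      ultimately show ?thesis
        unfolding T ss_rs by (auto simp: array_multiplicity_def of_nat_diff)
    next
      case False
      then have "K = {e}"
        using wK by simp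
      moreover have "card (V - K) = Suc (card (V - K - {w}))"
        using w False fin by (intro card.remove) auto
      ultimately show ?thesis
        unfolding T ss_rs by (auto simp: array_multiplicity_def)
    qed
  qed
  show ?thesis
    unfolding has_laplacian_spectrum_def V
  proof (intro conjI pg allI impI)
    fix vs \<mu> assume vs: "distinct vs \<and> set vs = V"
    have "similar_mat (laplacian_mat \<Gamma> vs) (kernel_mat ?T us us)"
      using similar_deflate[of vs V us w ?L] vs us w laplacian_entry_row_sum[OF fin sub]
      by (simp add: laplacian_mat_eq_kernel_mat)
    then show "int (Polynomial.order \<mu> (char_poly (laplacian_mat \<Gamma> vs))) = array_multiplicity
        [(0, 1), (1, int (card (V - K))), (real (card K), int (card K) - 2), (real (card V), 1)] \<mu>"
      by (simp add: char_poly_similar order_char_poly_kernel_mat_upper_triangular[OF tri] count)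
  qed
qed

section \<open>Enhanced power graphs of groups with involutions outside a cyclic subgroup\<close>

lemma (in group) generate_involution:
  assumes "x \<in> carrier G" "x \<otimes> x = \<one>"
  shows "generate G {x} = {\<one>, x}"
proof
  show "generate G {x} \<subseteq> {\<one>, x}"
  proof
    fix y assume "y \<in> generate G {x}"
    then show "y \<in> {\<one>, x}"
      by induction (use assms inv_equality in auto)
  qed
  show "{\<one>, x} \<subseteq> generate G {x}"
    by (auto intro: generate.intros)
qed

text \<open>A cyclic subgroup that is not contained in \<open>\<langle>a\<rangle>\<close> is generated by an involution \<open>z\<close> and
  contributes the single edge between \<open>\<one>\<close> and \<open>z\<close>.\<close>

lemma (in group) parcs_enhanced_power_graph_involutions:
  assumes a: "a \<in> carrier G"
    and square: "\<And>x. x \<in> carrier G \<Longrightarrow> x \<notin> generate G {a} \<Longrightarrow> x \<otimes> x = \<one>"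
  shows "parcs (enhanced_power_graph G) = {(x, y). x \<in> carrier G \<and> y \<in> carrier G \<and> x \<noteq> y \<and>
    (x = \<one> \<or> y = \<one> \<or> (x \<in> generate G {a} \<and> y \<in> generate G {a}))}"
proof -
  have "x = \<one> \<or> y = \<one> \<or> (x \<in> generate G {a} \<and> y \<in> generate G {a})"
    if "z \<in> carrier G" "x \<in> generate G {z}" "y \<in> generate G {z}" "x \<noteq> y" for x y z
  proof (cases "z \<in> generate G {a}")
    case True
    then have "generate G {z} \<subseteq> generate G {a}"
      using a generate_subgroup_incl[OF _ generate_is_subgroup[of "{a}"]] by simp
    then show ?thesis
      using that by auto
  next
    case False
    then show ?thesis
      using that square generate_involution by auto
  qed
  moreover have "\<one> \<in> generate G {x}" "x \<in> generate G {x}" for x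
    by (auto intro: generate.intros)
  ultimately show ?thesis
    using a unfolding enhanced_power_graph_def by simp blast
qed

section \<open>A cyclic subgroup inverted by an involution\<close>

lemma (in group) inverting_generate:
  assumes a: "a \<in> carrier G" and b: "b \<in> carrier G" and ba: "b \<otimes> a = inv a \<otimes> b"
    and x: "x \<in> generate G {a}"
  shows "b \<otimes> x = inv x \<otimes> b"
proof -
  have pow: "b \<otimes> a [^] k = inv (a [^] k) \<otimes> b" for k :: nat
  proof (induction k)
    case (Suc k)
    have "b \<otimes> a [^] Suc k = (b \<otimes> a [^] k) \<otimes> a"
      using a b by (simp add: m_assoc)
    also have "\<dots> = inv (a [^] k) \<otimes> (inv a \<otimes> b)"
      using a b by (simp add: Suc m_assoc ba)
    also have "\<dots> = inv (a \<otimes> a [^] k) \<otimes> b"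
      using a b by (simp add: inv_mult_group m_assoc)
    finally show ?case
      using nat_pow_Suc2[OF a, of k] by simp
  qed (use b in simp)
  have neg: "b \<otimes> inv y = y \<otimes> b" if y: "y \<in> carrier G" "b \<otimes> y = inv y \<otimes> b" for y
  proof -
    have "y \<otimes> b \<otimes> y = b"
      using y b by (simp add: m_assoc) (simp add: m_assoc[symmetric])
    then show ?thesis
      using y b by (metis inv_solve_right m_closed)
  qed
  obtain k :: int where k: "x = a [^] k"
    using x generate_pow[OF a] by auto
  show ?thesis
  proof (cases k rule: int_cases2)
    case (nonneg m)
    then show ?thesis
      using pow by (simp add: k int_pow_int)
  next
    case (nonpos m)
    then show ?thesis
      using neg[OF _ pow[of m]] a by (simp add: k int_pow_neg int_pow_int)
  qed
qed

lemma (in group) square_inverting_coset: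
  assumes a: "a \<in> carrier G" and b: "b \<in> carrier G" and bb: "b \<otimes> b = \<one>"
    and ba: "b \<otimes> a = inv a \<otimes> b" and x: "x \<in> generate G {a}"
  shows "(x \<otimes> b) \<otimes> (x \<otimes> b) = \<one>"
proof -
  have xG: "x \<in> carrier G"
    using x a generate_in_carrier[of "{a}"] by simp
  have "(x \<otimes> b) \<otimes> (x \<otimes> b) = x \<otimes> (b \<otimes> x) \<otimes> b"
    using xG b by (simp add: m_assoc)
  also have "\<dots> = (x \<otimes> inv x) \<otimes> (b \<otimes> b)"
    using xG b by (simp only: inverting_generate[OF a b ba x] m_assoc inv_closed m_closed)
  finally show ?thesis
    using xG bb by simp
qed

text \<open>As \<open>b x = x\<inverse> b\<close> for \<open>x \<in> \<langle>a\<rangle>\<close>, every product of elements of \<open>\<langle>a\<rangle> \<union> \<langle>a\<rangle>b\<close> can be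
  brought back into this set by moving the factors \<open>b\<close> to the right.\<close>

lemma (in group) generate_inverting_involution:
  assumes a: "a \<in> carrier G" and b: "b \<in> carrier G" and bb: "b \<otimes> b = \<one>"
    and ba: "b \<otimes> a = inv a \<otimes> b"
  shows "generate G {a, b} = generate G {a} \<union> (\<lambda>x. x \<otimes> b) ` generate G {a}"
proof
  let ?C = "generate G {a}"
  interpret C: subgroup ?C G
    by (rule generate_is_subgroup) (use a in simp)
  have inv_b: "inv b = b"
    using b bb inv_equality by simp
  have b_in: "b \<in> (\<lambda>x. x \<otimes> b) ` ?C"
    using b C.one_closed by (auto intro!: image_eqI[of _ _ \<one>])
  show "generate G {a, b} \<subseteq> ?C \<union> (\<lambda>x. x \<otimes> b) ` ?C"
  proof
    fix x assume "x \<in> generate G {a, b}"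
    then show "x \<in> ?C \<union> (\<lambda>x. x \<otimes> b) ` ?C"
    proof induction
      case (incl h)
      then show ?case
        using b_in generate.incl[of a "{a}" G] by auto
    next
      case (inv h)
      then show ?case
        using b_in inv_b generate.inv[of a "{a}" G] by auto
    next
      case (eng g h)
      have move: "(x \<otimes> b) \<otimes> y = (x \<otimes> inv y) \<otimes> b" if "x \<in> ?C" "y \<in> ?C" for x y
        using that b inverting_generate[OF a b ba, of y] by (simp add: m_assoc C.mem_carrier)
      have cancel: "(x \<otimes> b) \<otimes> (y \<otimes> b) = x \<otimes> inv y" if "x \<in> ?C" "y \<in> ?C" for x y
      proof -
        have "(x \<otimes> b) \<otimes> (y \<otimes> b) = (x \<otimes> b) \<otimes> y \<otimes> b"
          using that b by (simp add: m_assoc C.mem_carrier)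
        then show ?thesis
          unfolding move[OF that] using that b bb by (simp add: m_assoc C.mem_carrier)
      qed
      have assoc: "x \<otimes> (y \<otimes> b) = (x \<otimes> y) \<otimes> b" if "x \<in> ?C" "y \<in> ?C" for x y
        using that b by (simp add: m_assoc C.mem_carrier)
      show ?case
        using eng.IH by (elim UnE imageE) (simp_all add: move cancel assoc)
    qed (simp add: C.one_closed)
  qed
  have sub: "?C \<subseteq> generate G {a, b}"
    by (rule mono_generate) simp
  moreover have "x \<otimes> b \<in> generate G {a, b}" if "x \<in> ?C" for x
    using that sub by (auto intro: generate.eng generate.incl)
  ultimately show "?C \<union> (\<lambda>x. x \<otimes> b) ` ?C \<subseteq> generate G {a, b}"
    by auto
qed

lemma (in group) coset_disjoint:
  assumes "subgroup H G" "b \<in> carrier G" "b \<notin> H"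
  shows "H \<inter> (\<lambda>x. x \<otimes> b) ` H = {}"
proof -
  interpret H: subgroup H G by fact
  have "b \<in> H" if "x \<in> H" "x \<otimes> b \<in> H" for x
  proof -
    have "inv x \<otimes> (x \<otimes> b) \<in> H"
      using that by simp
    then show ?thesis
      using that assms(2) by (simp add: m_assoc[symmetric] H.mem_carrier)
  qed
  then show ?thesis
    using assms(3) by auto
qed

section \<open>Groups given by generators and relations\<close>

lemma inv_word_class:
  "inv\<^bsub>presented_group R\<^esub> (word_class R [(x, True)]) = word_class R [(x, False)]"
proof -
  interpret group "presented_group R"
    by (rule group_presented_group)
  show ?thesis
  proof (rule inv_equality)
    show "word_class R [(x, False)] \<otimes>\<^bsub>presented_group R\<^esub> word_class R [(x, True)]
        = \<one>\<^bsub>presented_group R\<^esub>"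
      using word_eq.cancel[of R x False]
      by (simp add: mult_word_class one_presented_group word_class_eq_iff)
  qed (simp_all add: carrier_presented_group)
qed

lemma carrier_presented_group_generate:
  "carrier (presented_group R) = generate (presented_group R) (range (\<lambda>x. word_class R [(x, True)]))"
    (is "_ = ?gen")
proof -
  interpret group "presented_group R"
    by (rule group_presented_group)
  have letter: "word_class R [(x, s)] \<in> ?gen" for x s
    using generate.incl[of "word_class R [(x, True)]" "range (\<lambda>x. word_class R [(x, True)])" "presented_group R"]
      generate.inv[of "word_class R [(x, True)]" "range (\<lambda>x. word_class R [(x, True)])" "presented_group R"]
    by (cases s) (simp_all add: inv_word_class)
  have "word_class R u \<in> ?gen" for u
  proof (induction u)
    case Nil
    then show ?case
      using generate.one[of "presented_group R"] by (simp add: one_presented_group)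
  next
    case (Cons c u)
    obtain x s where "c = (x, s)"
      by fastforce
    then show ?case
      using generate.eng[OF letter[of x s] Cons] by (simp add: mult_word_class)
  qed
  moreover have "?gen \<subseteq> carrier (presented_group R)"
    by (rule generate_incl) (auto simp: carrier_presented_group)
  ultimately show ?thesis
    by (auto simp: carrier_presented_group)
qed

section \<open>The dihedral group\<close>

text \<open>A word acts on the integers as \<open>t \<mapsto> r + \<epsilon> t\<close> if \<open>a\<close> acts as \<open>t \<mapsto> t + 1\<close> and \<open>b\<close> as
  \<open>t \<mapsto> - t\<close>; the two functions below compute \<open>\<epsilon>\<close> and \<open>r\<close>. The pair of \<open>\<epsilon>\<close> and \<open>r\<close> modulo \<open>n\<close>
  respects the dihedral relations. It is used in place of the action on the residues modulo \<open>n\<close>,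
  which is not faithful for \<open>n \<le> 2\<close>.\<close>

fun word_sign :: "dihedral_gen word \<Rightarrow> int" where
  "word_sign [] = 1"
| "word_sign ((Gen_a, _) # u) = word_sign u"
| "word_sign ((Gen_b, _) # u) = - word_sign u"

fun word_rotation :: "dihedral_gen word \<Rightarrow> int" where
  "word_rotation [] = 0"
| "word_rotation ((Gen_a, s) # u) = (if s then 1 else - 1) + word_rotation u"
| "word_rotation ((Gen_b, _) # u) = - word_rotation u"

lemma word_sign_append: "word_sign (u @ v) = word_sign u * word_sign v"
  by (induction u rule: word_sign.induct) auto

lemma word_rotation_append: "word_rotation (u @ v) = word_rotation u + word_sign u * word_rotation v"
  by (induction u rule: word_rotation.induct) auto

lemma word_sign_replicate_a: "word_sign (replicate k (Gen_a, True)) = 1"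
  by (induction k) auto

lemma word_rotation_replicate_a: "word_rotation (replicate k (Gen_a, True)) = int k"
  by (induction k) auto

lemma word_eq_dihedral_invariants:
  assumes "word_eq (dihedral_relations n) u v"
  shows "word_sign u = word_sign v \<and> int n dvd word_rotation u - word_rotation v"
  using assms
proof induction
  case (rel u v)
  then show ?case
    by (auto simp: dihedral_relations_def word_sign_replicate_a word_rotation_replicate_a)
next
  case (cancel x s)
  then show ?case
    by (cases x) auto
next
  case (sym u v)
  then show ?case
    by (auto simp: dvd_diff_commute)
next
  case (trans u v w)
  then show ?case
    using dvd_add[of "int n" "word_rotation u - word_rotation v" "word_rotation v - word_rotation w"]
    by simp
next
  case (append u u' v v')
  then have "int n dvd (word_rotation u - word_rotation u') + word_sign u' * (word_rotation v - word_rotation v')"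
    by (intro dvd_add dvd_mult) auto
  with append show ?case
    by (simp add: word_sign_append word_rotation_append algebra_simps)
qed auto

text \<open>The invariants bound the order of \<open>a\<close> from below and separate \<open>b\<close>, which has sign \<open>- 1\<close>, from
  the powers of \<open>a\<close>; everything else is read off from the presentation.\<close>

lemma dihedral_group_structure:
  fixes G (structure)
  assumes n: "n \<ge> 1" and G: "G = dihedral_group n"
  obtains a b where "a \<in> carrier G" "b \<in> carrier G" "group.ord G a = n" "b \<notin> generate G {a}"
    "b \<otimes> b = \<one>" "b \<otimes> a = inv a \<otimes> b" "carrier G = generate G {a, b}"
proof -
  define R where "R = dihedral_relations n"
  define a b where "a = word_class R [(Gen_a, True)]" and "b = word_class R [(Gen_b, True)]"
  have GR: "G = presented_group R"
    by (simp add: G R_def dihedral_group_def)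
  interpret group G
    unfolding GR by (rule group_presented_group)
  have relator: "word_class R u = word_class R v" if "(u, v) \<in> dihedral_relations n" for u v
    using that by (simp add: word_class_eq_iff R_def word_eq.rel)
  have ab: "a \<in> carrier G" "b \<in> carrier G"
    by (simp_all add: GR a_def b_def carrier_presented_group)
  have pow_a: "a [^] k = word_class R (replicate k (Gen_a, True))" for k :: nat
  proof (induction k)
    case (Suc k)
    have "a [^] Suc k = word_class R (replicate k (Gen_a, True)) \<otimes> a"
      using Suc by simp
    then show ?case
      by (simp add: GR mult_word_class a_def replicate_append_same)
  qed (simp add: GR one_presented_group)
  have a_n: "a [^] n = \<one>"
    unfolding pow_a unfolding GR one_presented_group
    by (rule relator) (simp add: dihedral_relations_def)
  have bb: "b \<otimes> b = \<one>"
    unfolding b_def unfolding GR mult_word_class one_presented_group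
    by (rule relator) (simp add: dihedral_relations_def)
  have "b \<otimes> a \<otimes> inv b = inv a"
    unfolding a_def b_def unfolding GR inv_word_class mult_word_class
    by (rule relator) (simp add: dihedral_relations_def)
  then have ba: "b \<otimes> a = inv a \<otimes> b"
    using ab by (metis inv_closed inv_solve_right' m_closed)
  have dvd: "n dvd k" if "a [^] k = \<one>" for k :: nat
  proof -
    have "word_eq R (replicate k (Gen_a, True)) []"
      using that unfolding pow_a by (simp add: GR one_presented_group word_class_eq_iff)
    then have "int n dvd int k"
      using word_eq_dihedral_invariants[of n "replicate k (Gen_a, True)" "[]"]
      by (simp add: R_def word_rotation_replicate_a)
    then show ?thesis
      by simp
  qed
  have pow: "a [^] k = \<one>" if n_k: "n dvd k" for k :: nat
  proof -
    obtain l where "k = n * l"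
      using n_k by (rule dvdE)
    then show ?thesis
      using nat_pow_pow[OF ab(1), of n l] a_n by simp
  qed
  have ord_a: "group.ord G a = n"
    unfolding ord_unique[OF ab(1)] using dvd pow by blast
  have b_out: "b \<notin> generate G {a}"
  proof
    assume "b \<in> generate G {a}"
    then obtain k :: nat where "b = a [^] k"
      using generate_pow_nat[OF ab(1)] ord_a n by auto
    then have "word_eq R [(Gen_b, True)] (replicate k (Gen_a, True))"
      unfolding pow_a by (simp add: b_def word_class_eq_iff)
    then show False
      using word_eq_dihedral_invariants[of n "[(Gen_b, True)]" "replicate k (Gen_a, True)"]
      by (simp add: R_def word_sign_replicate_a)
  qed
  have gens: "UNIV = {Gen_a, Gen_b}"
    using dihedral_gen.exhaust by blast
  have "range (\<lambda>x. word_class R [(x, True)]) = {a, b}"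
    unfolding a_def b_def gens by simp
  then have "carrier G = generate G {a, b}"
    using carrier_presented_group_generate[of R] by (simp add: GR)
  then show thesis
    using that ab ord_a b_out bb ba by blast
qed

theorem corollary4p8:
  fixes n :: nat
  assumes "n \<ge> 1"
  shows "has_laplacian_spectrum (enhanced_power_graph (dihedral_group n))
    [(0, 1), (1, int n), (real n, int n - 2), (2 * real n, 1)]"
proof -
  define G where "G = dihedral_group n"
  interpret group G
    unfolding G_def dihedral_group_def by (rule group_presented_group)
  obtain a b where a: "a \<in> carrier G" and b: "b \<in> carrier G" and ord: "group.ord G a = n"
    and b_out: "b \<notin> generate G {a}" and bb: "b \<otimes>\<^bsub>G\<^esub> b = \<one>\<^bsub>G\<^esub>"
    and ba: "b \<otimes>\<^bsub>G\<^esub> a = inv\<^bsub>G\<^esub> a \<otimes>\<^bsub>G\<^esub> b" and gen: "carrier G = generate G {a, b}"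
    using dihedral_group_structure[OF assms G_def] by metis
  let ?C = "generate G {a}" and ?D = "(\<lambda>x. x \<otimes>\<^bsub>G\<^esub> b) ` generate G {a}"
  have C: "?C \<subseteq> carrier G"
    using generate_incl[of "{a}"] a by simp
  have card_C: "card ?C = n" and fin_C: "finite ?C"
    using generate_pow_card[OF a] ord assms by (auto intro: card_ge_0_finite)
  have carrier: "carrier G = ?C \<union> ?D"
    using generate_inverting_involution[OF a b bb ba] gen by simp
  have disj: "?C \<inter> ?D = {}"
    using coset_disjoint[OF generate_is_subgroup, of "{a}" b] a b b_out by simp
  have "card ?D = n"
    using b C card_C by (subst card_image) (auto simp: inj_on_def subset_iff)
  then have card: "card (carrier G) = 2 * n" and card_diff: "card (carrier G - ?C) = n"
    unfolding carrier using disj fin_C card_C by (simp_all add: card_Un_disjoint Un_Diff Diff_triv Int_commute)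
  have square: "x \<otimes>\<^bsub>G\<^esub> x = \<one>\<^bsub>G\<^esub>" if "x \<in> carrier G" "x \<notin> ?C" for x
    using that carrier square_inverting_coset[OF a b bb ba] by auto
  have fin: "finite (carrier G)"
    unfolding carrier using fin_C by simp
  have "has_laplacian_spectrum (enhanced_power_graph G)
      [(0, 1), (1, int (card (carrier G - ?C))), (real (card ?C), int (card ?C) - 2),
       (real (card (carrier G)), 1)]"
    by (rule laplacian_spectrum_clique_with_pendants[OF fin _ C generate.one _
          parcs_enhanced_power_graph_involutions[OF a square]])
      (use assms card in \<open>auto simp: enhanced_power_graph_def\<close>)
  then show ?thesis
    unfolding card_diff card card_C by (simp add: G_def)
qed

end
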